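(* For every finite group $G$, the graph $\mathcal{RP}(G)$ is perfect.
   Context: For a group $G$, the reduced power graph $\mathcal{RP}(G)$ is the simple graph with vertex set $G$ in which $u,v$ are adjacent if and only if $\langle v\rangle\subset\langle u\rangle$ or $\langle u\rangle\subset\langle v\rangle$, where $\subset$ means proper inclusion. A graph $\Gamma$ is perfect if for every induced subgraph $H$ of $\Gamma$, the chromatic number of $H$ equals the size of the largest clique of $H$. *)

theory Defs
  imports "HOL-Algebra.Generated_Groups" "Graph_Theory.Graph_Theory"
begin

text \<open>
  A finite simple graph is represented, as in the entry Graph\_Theory, by a loop-free symmetric
  digraph without parallel arcs (locale \<^locale>\<open>graph\<close>), so that adjacency of
  \<open>u\<close> and \<open>v\<close> is \<^term>\<open>u \<rightarrow>\<^bsub>\<Gamma>\<^esub> v\<close>.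
\<close>

definition reduced_power_graph :: "('a, 'b) monoid_scheme \<Rightarrow> 'a pair_pre_digraph" where
  "reduced_power_graph G =
     \<lparr> pverts = carrier G,
       parcs = {(u, v). u \<in> carrier G \<and> v \<in> carrier G \<and>
                  (generate G {v} \<subset> generate G {u} \<or> generate G {u} \<subset> generate G {v})} \<rparr>"

definition proper_colouring :: "('a, 'b) pre_digraph \<Rightarrow> ('a \<Rightarrow> nat) \<Rightarrow> bool" where
  "proper_colouring \<Gamma> c \<longleftrightarrow> (\<forall>u v. u \<rightarrow>\<^bsub>\<Gamma>\<^esub> v \<longrightarrow> c u \<noteq> c v)"

definition colourable :: "('a, 'b) pre_digraph \<Rightarrow> nat \<Rightarrow> bool" where
  "colourable \<Gamma> k \<longleftrightarrow> (\<exists>c. proper_colouring \<Gamma> c \<and> c ` verts \<Gamma> \<subseteq> {..<k})"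

definition chromatic_number :: "('a, 'b) pre_digraph \<Rightarrow> nat" where
  "chromatic_number \<Gamma> = (LEAST k. colourable \<Gamma> k)"

definition is_clique :: "('a, 'b) pre_digraph \<Rightarrow> 'a set \<Rightarrow> bool" where
  "is_clique \<Gamma> K \<longleftrightarrow> K \<subseteq> verts \<Gamma> \<and> (\<forall>u\<in>K. \<forall>v\<in>K. u \<noteq> v \<longrightarrow> u \<rightarrow>\<^bsub>\<Gamma>\<^esub> v)"

definition clique_number :: "('a, 'b) pre_digraph \<Rightarrow> nat" where
  "clique_number \<Gamma> = Max (card ` {K. is_clique \<Gamma> K})"

text \<open>
  The conjunct \<^term>\<open>graph \<Gamma>\<close> is needed because \<^const>\<open>induced_subgraph\<close> presupposes
  well-formed digraphs, so that without it a malformed \<open>\<Gamma>\<close> would be vacuously perfect;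
  finiteness is what makes the \<open>LEAST\<close> and the \<^const>\<open>Max\<close> above meaningful.
\<close>

definition perfect_graph :: "('a, 'b) pre_digraph \<Rightarrow> bool" where
  "perfect_graph \<Gamma> \<longleftrightarrow> graph \<Gamma> \<and>
     (\<forall>H. induced_subgraph H \<Gamma> \<longrightarrow> chromatic_number H = clique_number H)"

lemma graph_reduced_power_graph:
  fixes G (structure)
  assumes "finite (carrier G)"
  shows "graph (with_proj (reduced_power_graph G))"
proof -
  have "finite (parcs (reduced_power_graph G))"
    by (rule finite_subset[of _ "carrier G \<times> carrier G"])
      (use assms in \<open>auto simp: reduced_power_graph_def\<close>)
  then show ?thesis
    using assms
    by unfold_locales
      (auto simp: reduced_power_graph_def arc_to_ends_def symmetric_def sym_def)
qed

lemma (in graph) colourable_card_verts: "colourable G (card (verts G))"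
proof -
  obtain c where c: "bij_betw c (verts G) {0..<card (verts G)}"
    using ex_bij_betw_finite_nat[OF finite_verts] by blast
  have "proper_colouring G c"
    unfolding proper_colouring_def
    using c adj_in_verts adj_not_same by (metis bij_betw_imp_inj_on inj_onD)
  moreover have "c ` verts G \<subseteq> {..<card (verts G)}"
    using bij_betw_imp_surj_on[OF c] by auto
  ultimately show ?thesis
    unfolding colourable_def by blast
qed

lemma (in graph) cliques_finite_nonempty:
  "finite {K. is_clique G K}" "{K. is_clique G K} \<noteq> {}"
proof -
  show "finite {K. is_clique G K}"
    by (rule finite_subset[of _ "Pow (verts G)"]) (auto simp: is_clique_def)
  have "is_clique G {}"
    by (simp add: is_clique_def)
  then show "{K. is_clique G K} \<noteq> {}"
    by blast
qed

end

theory Submission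
  imports Defs
begin

text \<open>
  Adjacency in the reduced power graph is comparability of \<open>u\<close> and \<open>v\<close> under the strict partial
  order \<open>\<langle>u\<rangle> \<subset> \<langle>v\<rangle>\<close>, so the graph is a comparability graph, and so is each of its induced
  subgraphs. In a finite comparability graph, colour every vertex by the largest size of a chain of
  which it is the greatest element. By transitivity a longest chain below \<open>u\<close> can be
  extended by any \<open>v\<close> above \<open>u\<close>, so this colouring is proper; and since chains are
  cliques, it uses at most as many colours as the largest clique has vertices. No proper colouring
  uses fewer, so chromatic number and clique number agree. The group structure plays no role beyond
  the order that it induces.
\<close>

text \<open>
  The vertices are partially ordered by \<open>r\<close>, and two of them are adjacent when one lies
  strictly below the other. Irreflexivity of \<open>r\<close> on the vertices is not demanded: it holds
  because \<open>\<Gamma>\<close> has no loops. Transitivity is demanded on the whole type,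
  not only on the vertices.
\<close>
definition comparability_graph :: "('a \<Rightarrow> 'a \<Rightarrow> bool) \<Rightarrow> ('a, 'b) pre_digraph \<Rightarrow> bool" where
  "comparability_graph r \<Gamma> \<longleftrightarrow> graph \<Gamma> \<and> transp r \<and>
     (\<forall>u\<in>verts \<Gamma>. \<forall>v\<in>verts \<Gamma>. u \<rightarrow>\<^bsub>\<Gamma>\<^esub> v \<longleftrightarrow> r u v \<or> r v u)"

text \<open>
  The chains with greatest element \<open>v\<close>, as cliques whose other members all lie below \<open>v\<close>.
\<close>
definition chains_to :: "('a \<Rightarrow> 'a \<Rightarrow> bool) \<Rightarrow> ('a, 'b) pre_digraph \<Rightarrow> 'a \<Rightarrow> 'a set set" where
  "chains_to r \<Gamma> v = {K. is_clique \<Gamma> K \<and> v \<in> K \<and> (\<forall>w\<in>K - {v}. r w v)}"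

text \<open>
  The height of a vertex counts vertices rather than steps, so minimal vertices have height 1.
\<close>
definition height :: "('a \<Rightarrow> 'a \<Rightarrow> bool) \<Rightarrow> ('a, 'b) pre_digraph \<Rightarrow> 'a \<Rightarrow> nat" where
  "height r \<Gamma> v = Max (card ` chains_to r \<Gamma> v)"

context graph
begin

lemma card_clique_le_clique_number:
  assumes "is_clique G K"
  shows "card K \<le> clique_number G"
  unfolding clique_number_def
  using assms cliques_finite_nonempty by (intro Max_ge) auto

lemma card_clique_le_colours:
  assumes "is_clique G K" "colourable G k"
  shows "card K \<le> k"
proof -
  obtain c where c: "proper_colouring G c" "c ` verts G \<subseteq> {..<k}"
    using assms(2) unfolding colourable_def by blast
  have "inj_on c K"
    using assms(1) c(1) unfolding is_clique_def proper_colouring_def inj_on_def by blast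
  moreover have "c ` K \<subseteq> {..<k}"
    using assms(1) c(2) unfolding is_clique_def by blast
  ultimately show ?thesis
    using card_inj_on_le[of c K "{..<k}"] by simp
qed

lemma clique_number_le_chromatic_number: "clique_number G \<le> chromatic_number G"
proof -
  have "colourable G (chromatic_number G)"
    unfolding chromatic_number_def using colourable_card_verts by (rule LeastI)
  then show ?thesis
    unfolding clique_number_def
    using cliques_finite_nonempty card_clique_le_colours by (subst Max_le_iff) auto
qed

lemma finite_chains_to: "finite (chains_to r G v)"
  unfolding chains_to_def using cliques_finite_nonempty(1) by (rule rev_finite_subset) blast

lemma singleton_in_chains_to: "v \<in> verts G \<Longrightarrow> {v} \<in> chains_to r G v"
  unfolding chains_to_def is_clique_def by simp

lemma card_le_height: "K \<in> chains_to r G v \<Longrightarrow> card K \<le> height r G v"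
  unfolding height_def using finite_chains_to by (intro Max_ge) auto

lemma height_attained:
  assumes "v \<in> verts G"
  obtains K where "K \<in> chains_to r G v" "card K = height r G v"
proof -
  have "height r G v \<in> card ` chains_to r G v"
    unfolding height_def using finite_chains_to singleton_in_chains_to[OF assms]
    by (intro Max_in) auto
  then show thesis
    using that by auto
qed

text \<open>
  Transitivity enters here: it puts every member of a longest chain to \<open>u\<close> below \<open>v\<close>, so
  that adding \<open>v\<close> gives a longer chain.
\<close>
lemma height_less:
  assumes "comparability_graph r G" "u \<in> verts G" "v \<in> verts G" "r u v"
  shows "height r G u < height r G v"
proof -
  have adj: "x \<rightarrow>\<^bsub>G\<^esub> y \<longleftrightarrow> r x y \<or> r y x" if "x \<in> verts G" "y \<in> verts G" for x y
    using assms(1) that unfolding comparability_graph_def by blast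
  obtain K where K: "K \<in> chains_to r G u" "card K = height r G u"
    using height_attained[OF assms(2)] .
  have K_verts: "K \<subseteq> verts G" and clique: "\<And>x y. x \<in> K \<Longrightarrow> y \<in> K \<Longrightarrow> x \<noteq> y \<Longrightarrow> x \<rightarrow>\<^bsub>G\<^esub> y"
    using K(1) unfolding chains_to_def is_clique_def by auto
  have below: "r w v" if "w \<in> K" for w
  proof (cases "w = u")
    case False
    then have "r w u"
      using K(1) that unfolding chains_to_def by blast
    then show ?thesis
      using assms(1,4) unfolding comparability_graph_def by (blast dest: transpD)
  qed (use assms(4) in simp)
  \<comment> \<open>Otherwise \<open>r v v\<close>, which would put a loop at \<open>v\<close>.\<close>
  have "v \<notin> K"
    using below[of v] adj[of v v] assms(3) adj_not_same by blast
  have "is_clique G (insert v K)"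
    using K_verts clique below adj assms(3) unfolding is_clique_def by blast
  then have "insert v K \<in> chains_to r G v"
    using below unfolding chains_to_def by blast
  then have "card (insert v K) \<le> height r G v"
    by (rule card_le_height)
  moreover have "finite K"
    using K_verts finite_verts by (rule finite_subset)
  ultimately show ?thesis
    using \<open>v \<notin> K\<close> K(2) by simp
qed

lemma colourable_clique_number:
  assumes "comparability_graph r G"
  shows "colourable G (clique_number G)"
proof -
  \<comment> \<open>Heights range from 1 to the clique number, colours from 0.\<close>
  define c where "c v = height r G v - 1" for v
  have pos: "height r G v > 0" if "v \<in> verts G" for v
    using card_le_height[OF singleton_in_chains_to[OF that], of r] by simp
  have "c u \<noteq> c v" if "u \<rightarrow>\<^bsub>G\<^esub> v" for u v
  proof -
    have uv: "u \<in> verts G" "v \<in> verts G"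
      using that adj_in_verts by blast+
    then have "r u v \<or> r v u"
      using that assms unfolding comparability_graph_def by blast
    then have "height r G u \<noteq> height r G v"
      using height_less[OF assms] uv by (metis less_irrefl)
    then show ?thesis
      using pos[OF uv(1)] pos[OF uv(2)] unfolding c_def by linarith
  qed
  moreover have "c v < clique_number G" if v: "v \<in> verts G" for v
  proof -
    obtain K where "K \<in> chains_to r G v" "card K = height r G v"
      using height_attained[OF v] .
    then have "height r G v \<le> clique_number G"
      using card_clique_le_clique_number unfolding chains_to_def by fastforce
    then show ?thesis
      using pos[OF v] unfolding c_def by linarith
  qed
  ultimately show ?thesis
    unfolding colourable_def proper_colouring_def by (intro exI[of _ c]) auto
qed

end

lemma chromatic_number_comparability_graph:
  assumes "comparability_graph r \<Gamma>"
  shows "chromatic_number \<Gamma> = clique_number \<Gamma>"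
proof -
  interpret graph \<Gamma>
    using assms unfolding comparability_graph_def by blast
  have "chromatic_number \<Gamma> \<le> clique_number \<Gamma>"
    unfolding chromatic_number_def using colourable_clique_number[OF assms] by (rule Least_le)
  then show ?thesis
    using clique_number_le_chromatic_number by simp
qed

lemma induced_subgraph_dominates_iff:
  assumes "induced_subgraph H \<Gamma>" "u \<in> verts H" "v \<in> verts H"
  shows "u \<rightarrow>\<^bsub>H\<^esub> v \<longleftrightarrow> u \<rightarrow>\<^bsub>\<Gamma>\<^esub> v"
proof -
  have "tail H = tail \<Gamma>" "head H = head \<Gamma>"
    using assms(1) unfolding induced_subgraph_def subgraph_def compatible_def by auto
  moreover have "arcs H = {e \<in> arcs \<Gamma>. tail \<Gamma> e \<in> verts H \<and> head \<Gamma> e \<in> verts H}"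
    using assms(1) unfolding induced_subgraph_def by auto
  ultimately show ?thesis
    using assms(2,3) unfolding arcs_ends_def arc_to_ends_def by auto
qed

lemma comparability_graph_induced_subgraph:
  assumes "comparability_graph r \<Gamma>" "induced_subgraph H \<Gamma>"
  shows "comparability_graph r H"
proof -
  interpret graph \<Gamma>
    using assms(1) unfolding comparability_graph_def by blast
  have "graph H"
    using digraphI_induced[OF assms(2)] induced_graph_imp_symmetric[OF sym_arcs assms(2)]
    by (rule digraph.graphI)
  moreover have "verts H \<subseteq> verts \<Gamma>"
    using assms(2) unfolding induced_subgraph_def subgraph_def by blast
  ultimately show ?thesis
    using assms(1) induced_subgraph_dominates_iff[OF assms(2)]
    unfolding comparability_graph_def by blast
qed

theorem perfect_comparability_graph:
  assumes "comparability_graph r \<Gamma>"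
  shows "perfect_graph \<Gamma>"
  using assms comparability_graph_induced_subgraph chromatic_number_comparability_graph
  unfolding perfect_graph_def by (metis comparability_graph_def)

theorem theorem3p1:
  fixes G :: "('a, 'b) monoid_scheme"
  assumes "group G" and "finite (carrier G)"
  shows "perfect_graph (with_proj (reduced_power_graph G))"
proof (rule perfect_comparability_graph)
  let ?r = "\<lambda>u v. generate G {u} \<subset> generate G {v}"
  have "transp ?r"
    by (rule transpI) (rule psubset_trans)
  then show "comparability_graph ?r (with_proj (reduced_power_graph G))"
    using graph_reduced_power_graph[OF assms(2)]
    unfolding comparability_graph_def
    by (auto simp: reduced_power_graph_def arcs_ends_def arc_to_ends_def)
qed

end
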